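(* For $a\in(0,1/2]$ let $\lambda=\lambda(a)=\dfrac{2a(1-a)(1-a+a^2)}{a^2+(1-a)^2}$, and write $r'=\sqrt{1-r^2}$, $t'=\sqrt{1-t^2}$. Then for all $a\in(0,1/2]$, $r\in(0,1)$, $t\in(0,1)$ and $K\in(1,\infty)$, $$\frac{\varphi_K^a(r)\varphi_K^a(t)}{\varphi_K^a(rt)}<e^{\frac{R(a)}{4}\left((r')^{2-\lambda}+(t')^{2-\lambda}\right)\left(1-\frac1K\right)},$$ $$\frac{\varphi_K^a(r)^p}{\varphi_K^a(r^p)}>e^{\frac{R(a)}{2}(p-1)(r')^{2-\lambda}\left(1-\frac1K\right)}\quad\text{for } p\in(0,1),$$ $$\frac{\varphi_K^a(r)^p}{\varphi_K^a(r^p)}<e^{\frac{R(a)}{2}(p-1)(r')^{2-\lambda}\left(1-\frac1K\right)}\quad\text{for } p\in(1,\infty).$$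
   Context: $F(\alpha,\beta;c;x)=\sum_{n=0}^\infty\frac{(\alpha)_n(\beta)_n}{(c)_n}\frac{x^n}{n!}$, $|x|<1$, is the Gaussian hypergeometric function, with $(x)_0=1$, $(x)_n=x(x+1)\cdots(x+n-1)$. For $a\in(0,1/2]$ and $r\in(0,1)$ the generalized Grötzsch ring function is $\mu_a(r)=\frac{\pi}{2\sin(\pi a)}\frac{F(a,1-a;1;1-r^2)}{F(a,1-a;1;r^2)}$, a strictly decreasing homeomorphism from $(0,1)$ onto $(0,\infty)$; for $K\in(0,\infty)$ the generalized Hersch–Pfluger distortion function is $\varphi_K^a(r)=\mu_a^{-1}(\mu_a(r)/K)$. The notation $\varphi_K^a(r)^p$ means $(\varphi_K^a(r))^p$. The Ramanujan constant is $R(a)=-2\gamma-\psi(a)-\psi(1-a)$, where $\psi=\Gamma'/\Gamma$ is the digamma function and $\gamma$ is the Euler–Mascheroni constant. *)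

theory Defs
  imports "HOL-Analysis.Analysis"
begin

definition hyp2F1 :: "real \<Rightarrow> real \<Rightarrow> real \<Rightarrow> real \<Rightarrow> real" where
  "hyp2F1 \<alpha> \<beta> c x =
     (\<Sum>n. pochhammer \<alpha> n * pochhammer \<beta> n / pochhammer c n * (x ^ n / fact n))"

definition mu :: "real \<Rightarrow> real \<Rightarrow> real" where
  "mu a r = pi / (2 * sin (pi * a)) *
     (hyp2F1 a (1 - a) 1 (1 - r\<^sup>2) / hyp2F1 a (1 - a) 1 (r\<^sup>2))"

(* mu a is used only on the open interval (0,1), which it maps bijectively onto the
   positive reals for 0 < a <= 1/2, so its inverse is taken relative to (0,1). *)
definition phi :: "real \<Rightarrow> real \<Rightarrow> real \<Rightarrow> real" where
  "phi a K r = inv_into {0<..<1} (mu a) (mu a r / K)"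

definition ramanujan_R :: "real \<Rightarrow> real" where
  "ramanujan_R a = - 2 * euler_mascheroni - Digamma a - Digamma (1 - a)"

definition lam :: "real \<Rightarrow> real" where
  "lam a = 2 * a * (1 - a) * (1 - a + a\<^sup>2) / (a\<^sup>2 + (1 - a)\<^sup>2)"

definition compl_mod :: "real \<Rightarrow> real" where
  "compl_mod r = sqrt (1 - r\<^sup>2)"

end

theory Submission
  imports Defs
begin

text \<open>
  Put \<open>x = r\<^sup>2\<close>, \<open>F x = F(a, 1 - a; 1; x)\<close>, \<open>C = sin (\<pi> a) / \<pi>\<close> and
  \<open>M x = F (1 - x) / (2 C F x)\<close>, so that \<open>\<mu>\<^sub>a(r) = M (r\<^sup>2)\<close>. The theorem is a statement about the one function
  \<open>L K r = ln (\<phi>\<^sub>K(r)) - ln r / K\<close>: as the logarithm is additive, the powers of \<open>r\<close> and \<open>t\<close> cancel and the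
  quotients are the exponentials of \<open>L K r + L K t - L K (r t)\<close> and \<open>p L K r - L K (r\<^sup>p)\<close>. Two facts suffice.
  First, \<open>L K\<close> is strictly decreasing (\<open>L_strict_antimono\<close>), so \<open>L K (r t)\<close> exceeds \<open>L K r\<close> and \<open>L K t\<close>, hence
  also their mean, and \<open>L K (r\<^sup>p)\<close> lies above or below \<open>L K r\<close> according as \<open>p > 1\<close> or \<open>p < 1\<close>. Secondly,
  \<open>L K r \<le> (1 - 1 / K) (R / 2) r'\<^bsup>2 - \<lambda>\<^esup>\<close> (\<open>L_le\<close>).

  Both facts come from concavity. In the coordinate \<open>m = M x\<close> the distortion function is the scaling
  \<open>m \<mapsto> m / K\<close>. The Wronskian of \<open>F x\<close> and \<open>F (1 - x)\<close> gives \<open>M' = - 1 / (2 x h)\<close> with \<open>h x = (1 - x) (F x)\<^sup>2\<close>, so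
  \<open>ln x\<close> as a function of \<open>m\<close> has the derivative \<open>- 2 h\<close>. Since \<open>h\<close> decreases in \<open>x\<close>, it increases in \<open>m\<close>,
  and \<open>ln x\<close> is concave in \<open>m\<close>. Comparing slopes at \<open>m / K\<close> and \<open>m\<close> gives the monotonicity of \<open>L K\<close>; the
  tangent at \<open>m\<close> gives \<open>L K r \<le> (1 - 1 / K) W x\<close>, where \<open>W x = h x M x + ln x / 2\<close> is half the intercept of
  that tangent.

  It remains to see that \<open>W x \<le> (R / 2) (1 - x)\<^bsup>1 - \<lambda> / 2\<^esup>\<close> (\<open>W_le\<close>). Both sides vanish at \<open>x = 1\<close>. The
  quotient of their derivatives is a constant times \<open>F (1 - x) P x (1 - x)\<^bsup>\<lambda> / 2\<^esup>\<close> with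
  \<open>P x = F x - 2 (1 - x) F' x\<close>, and \<open>\<lambda> / 2\<close> is the least exponent for which \<open>P x (1 - x)\<^bsup>\<lambda> / 2\<^esup>\<close>
  decreases. By the monotone form of l'Hospital's rule \<open>W x / (1 - x)\<^bsup>1 - \<lambda> / 2\<^esup>\<close> decreases too, and is bounded
  by its limit at \<open>0\<close>, which is \<open>R / 2\<close>.

  The constants \<open>C\<close> and \<open>R\<close> enter through the connection formula \<open>F (1 - x) = C (g x - F x ln x)\<close>, where
  \<open>g 0 = R\<close> (\<open>connection_formula\<close>). Both sides solve the hypergeometric equation and have the same Wronskian with
  \<open>F\<close>, so they differ by a multiple of \<open>F\<close>; that multiple is \<open>0\<close> because \<open>F\<close> is unbounded at \<open>1\<close> while both sides
  are \<open>o(F)\<close> there. The growth at \<open>1\<close> is read off the coefficients: those of \<open>F\<close> are asymptotic to \<open>C / n\<close> by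
  the product formula for the Gamma function, and those of \<open>g\<close> are \<open>o(1 / n)\<close> by the series for the digamma
  function.
\<close>

section \<open>One-sided limits\<close>

lemma at_left_1: "\<forall>\<^sub>F x in at_left (1::real). 0 < x \<and> x < 1"
  using eventually_at_left_real[of 0 "1::real"] by simp

lemma one_minus_at_right_0: "filterlim (\<lambda>x::real. 1 - x) (at_right 0) (at_left 1)"
proof -
  have "((\<lambda>x::real. 1 - x) \<longlongrightarrow> 1 - 1) (at_left 1)"
    by (intro tendsto_intros)
  moreover have "\<forall>\<^sub>F x::real in at_left 1. 1 - x > 0"
    by (auto simp: eventually_at_filter)
  ultimately show ?thesis
    by (simp add: filterlim_at eventually_mono)
qed

lemma filterlim_inverse_at_left_1: "filterlim (\<lambda>x::real. 1 / (1 - x)) at_top (at_left 1)"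
  using filterlim_compose[OF filterlim_inverse_at_top_right one_minus_at_right_0]
  by (simp add: inverse_eq_divide)

lemma x_ln_x_tendsto_0: "((\<lambda>x::real. x * ln x) \<longlongrightarrow> 0) (at_right 0)"
proof -
  have "((\<lambda>x::real. - (ln (inverse x) / inverse x)) \<longlongrightarrow> - 0) (at_right 0)"
    by (intro tendsto_minus filterlim_compose[OF ln_x_over_x_tendsto_0 filterlim_inverse_at_top_right])
  then have "((\<lambda>x::real. - (ln (inverse x) / inverse x)) \<longlongrightarrow> 0) (at_right 0)" by simp
  moreover have "\<forall>\<^sub>F x::real in at_right 0. - (ln (inverse x) / inverse x) = x * ln x"
    using eventually_at_right_less[of "0::real"]
    by (rule eventually_mono) (simp add: ln_inverse divide_inverse)
  ultimately show ?thesis by (rule Lim_transform_eventually)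
qed

section \<open>Power series with bounded coefficients\<close>

lemma summable_Bseq_power:
  fixes f :: "nat \<Rightarrow> real"
  assumes "Bseq f" and "\<bar>x\<bar> < 1"
  shows "summable (\<lambda>n. f n * x ^ n)"
proof -
  obtain B where B: "\<And>n. norm (f n) \<le> B"
    using assms(1) unfolding Bseq_def by blast
  have "summable (\<lambda>n. B * \<bar>x\<bar> ^ n)"
    using assms(2) by (intro summable_mult summable_geometric) auto
  then show ?thesis
    by (rule summable_comparison_test')
       (use B in \<open>auto simp: abs_mult power_abs intro!: mult_right_mono\<close>)
qed

lemma DERIV_Bseq_power:
  fixes f :: "nat \<Rightarrow> real"
  assumes "Bseq f" and "\<bar>x\<bar> < 1"
  shows "((\<lambda>x. \<Sum>n. f n * x ^ n) has_real_derivative (\<Sum>n. diffs f n * x ^ n)) (at x)"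
  by (rule termdiffs_strong'[where K = 1]) (use assms summable_Bseq_power in auto)

lemma summable_diffs_Bseq_power:
  fixes f :: "nat \<Rightarrow> real"
  assumes "Bseq f" and "\<bar>x\<bar> < 1"
  shows "summable (\<lambda>n. diffs f n * x ^ n)"
  by (rule termdiff_converges[where K = 1]) (use assms summable_Bseq_power in auto)

lemma Bseq_div_Suc:
  fixes q :: "nat \<Rightarrow> real"
  assumes "Bseq q"
  shows "Bseq (\<lambda>n. q n / real (Suc n))"
proof -
  have "Bseq (\<lambda>n. 1 / real (Suc n))"
    by (rule BseqI'[where K = 1]) (auto simp: field_simps)
  from Bseq_mult[OF assms this] show ?thesis
    by simp
qed

text \<open>
  Multiplication by \<open>1 - x\<close> turns the coefficients of the derivative into differences. For a hypergeometric
  coefficient sequence these differences are simple multiples of the coefficients themselves.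
\<close>

lemma euler_operator_sums:
  fixes f :: "nat \<Rightarrow> real"
  assumes f: "Bseq f" and x: "\<bar>x\<bar> < 1"
  shows "(\<lambda>n. (diffs f n - real n * f n) * x ^ n) sums ((1 - x) * (\<Sum>n. diffs f n * x ^ n))"
proof -
  let ?D = "\<Sum>n. diffs f n * x ^ n"
  have D: "(\<lambda>n. diffs f n * x ^ n) sums ?D"
    by (intro summable_sums summable_diffs_Bseq_power f x)
  have "(\<lambda>n. x * (diffs f n * x ^ n)) sums (x * ?D)"
    by (intro sums_mult D)
  then have "(\<lambda>n. (Suc n * f (Suc n)) * x ^ Suc n) sums (x * ?D)"
    by (simp add: diffs_def mult_ac)
  then have "(\<lambda>n. (n * f n) * x ^ n) sums (x * ?D)"
    using sums_Suc_iff[of "\<lambda>n. (n * f n) * x ^ n" "x * ?D"] by simp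
  from sums_diff[OF D this] show ?thesis
    by (simp add: left_diff_distrib)
qed

text \<open>
  In this form a two-term recursion for the coefficients becomes the self-adjoint form
  \<open>(x (1 - x) f')' = q\<close> of the hypergeometric equation, from which the Wronskians below are constant by
  inspection.
\<close>

lemma euler_operator_deriv:
  fixes f q :: "nat \<Rightarrow> real"
  assumes f: "Bseq f" and q: "Bseq q"
    and rec: "\<And>n. diffs f n - real n * f n = q n / real (Suc n)"
    and x: "\<bar>x\<bar> < 1"
  shows "((\<lambda>x. x * (1 - x) * (\<Sum>n. diffs f n * x ^ n)) has_real_derivative
           (\<Sum>n. q n * x ^ n)) (at x)"
proof -
  define k where "k = (\<lambda>n. case n of 0 \<Rightarrow> 0 | Suc m \<Rightarrow> q m / real (Suc m))"
  have kB: "Bseq k"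
    using Bseq_div_Suc[OF q] unfolding Bseq_Suc_iff[symmetric, of k] by (simp add: k_def)
  have dk: "diffs k = q"
    by (simp add: diffs_def k_def fun_eq_iff)
  have eq: "y * (1 - y) * (\<Sum>n. diffs f n * y ^ n) = (\<Sum>n. k n * y ^ n)"
    if y: "\<bar>y\<bar> < 1" for y
  proof -
    have "(\<lambda>n. q n / real (Suc n) * y ^ n) sums (\<Sum>n. q n / real (Suc n) * y ^ n)"
      by (intro summable_sums summable_Bseq_power Bseq_div_Suc q y)
    then have "(\<lambda>n. y * (q n / real (Suc n) * y ^ n)) sums (y * (\<Sum>n. q n / real (Suc n) * y ^ n))"
      by (rule sums_mult)
    then have "(\<lambda>n. k (Suc n) * y ^ Suc n) sums (y * (\<Sum>n. q n / real (Suc n) * y ^ n))"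
      by (simp add: k_def mult_ac)
    then have "(\<lambda>n. k n * y ^ n) sums (y * (\<Sum>n. q n / real (Suc n) * y ^ n))"
      using sums_Suc_iff[of "\<lambda>n. k n * y ^ n"] by (simp add: k_def)
    then show ?thesis
      using euler_operator_sums[OF f y] by (simp add: rec sums_iff mult.assoc)
  qed
  have "((\<lambda>x. \<Sum>n. k n * x ^ n) has_real_derivative (\<Sum>n. q n * x ^ n)) (at x)"
    using DERIV_Bseq_power[OF kB x] unfolding dk .
  then show ?thesis
    by (rule has_field_derivative_transform_within_open[where S = "{-1<..<1}"])
       (use x eq in auto)
qed

text \<open>
  The Abelian principle behind all limits at \<open>1\<close>: as the total weight tends to infinity, any finite initial
  segment becomes negligible, so the weighted mean of \<open>e\<close> only sees its tail.
\<close>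

lemma powser_ratio_tendsto_zero:
  fixes w e :: "nat \<Rightarrow> real"
  assumes w: "\<And>n. w n \<ge> 0"
    and e: "e \<longlonglongrightarrow> 0"
    and sm: "\<And>x. 0 < x \<Longrightarrow> x < 1 \<Longrightarrow> summable (\<lambda>n. w n * x ^ n)"
    and lim: "filterlim (\<lambda>x. \<Sum>n. w n * x ^ n) at_top (at_left 1)"
  shows "((\<lambda>x. (\<Sum>n. w n * e n * x ^ n) / (\<Sum>n. w n * x ^ n)) \<longlongrightarrow> 0) (at_left 1)"
proof (rule tendstoI)
  fix \<epsilon> :: real assume \<epsilon>: "\<epsilon> > 0"
  let ?W = "\<lambda>x. \<Sum>n. w n * x ^ n"
  from e \<epsilon> have "\<forall>\<^sub>F n in sequentially. \<bar>e n\<bar> < \<epsilon> / 2"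
    using tendstoD[of e 0 sequentially "\<epsilon> / 2"] by simp
  then obtain N where N: "\<And>n. n \<ge> N \<Longrightarrow> \<bar>e n\<bar> < \<epsilon> / 2"
    by (auto simp: eventually_sequentially)
  define S where "S = (\<Sum>n<N. w n * \<bar>e n\<bar>)"
  have S0: "S \<ge> 0" unfolding S_def by (intro sum_nonneg) (simp add: w)
  have "\<forall>\<^sub>F x in at_left 1. ?W x > 2 * S / \<epsilon> + 1"
    using lim by (simp add: filterlim_at_top_dense)
  with at_left_1 show "\<forall>\<^sub>F x in at_left 1. dist ((\<Sum>n. w n * e n * x ^ n) / ?W x) 0 < \<epsilon>"
  proof eventually_elim
    case (elim x)
    then have x: "0 < x" "x < 1" by auto
    have Wpos: "?W x > 0"
    proof -
      have "0 \<le> 2 * S / \<epsilon>" using S0 \<epsilon> by simp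
      then show ?thesis using elim(2) by linarith
    qed
    let ?t = "\<lambda>n. (if n \<in> {..<N} then w n * \<bar>e n\<bar> else 0) + \<epsilon> / 2 * (w n * x ^ n)"
    have t: "?t sums (S + \<epsilon> / 2 * ?W x)"
      unfolding S_def by (intro sums_add sums_If_finite_set sums_mult summable_sums sm x) auto
    have le: "\<bar>w n * e n * x ^ n\<bar> \<le> ?t n" for n
    proof (cases "n < N")
      case True
      have "w n * \<bar>e n\<bar> * x ^ n \<le> w n * \<bar>e n\<bar> * 1"
        using x w by (intro mult_left_mono power_le_one) auto
      then show ?thesis using True x w[of n] \<epsilon> by (simp add: abs_mult add_increasing2)
    next
      case False
      then have "\<bar>e n\<bar> * (w n * x ^ n) \<le> \<epsilon> / 2 * (w n * x ^ n)"
        using N[of n] x w[of n] by (intro mult_right_mono) auto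
      then show ?thesis using False x w[of n] by (simp add: abs_mult mult_ac)
    qed
    have sa: "summable (\<lambda>n. \<bar>w n * e n * x ^ n\<bar>)"
      by (rule summable_comparison_test'[OF sums_summable[OF t]]) (use le in auto)
    have "\<bar>\<Sum>n. w n * e n * x ^ n\<bar> \<le> (\<Sum>n. \<bar>w n * e n * x ^ n\<bar>)"
      by (rule summable_rabs[OF sa])
    also have "\<dots> \<le> (\<Sum>n. ?t n)"
      by (rule suminf_le[OF le sa sums_summable[OF t]])
    also have "\<dots> = S + \<epsilon> / 2 * ?W x"
      using t by (rule sums_unique[symmetric])
    also have "\<dots> < \<epsilon> * ?W x"
      using elim(2) \<epsilon> by (simp add: field_simps)
    finally show ?case
      using Wpos by (simp add: abs_divide field_simps)
  qed
qed

text \<open>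
  The case of constant weights, normalized by the geometric series.
\<close>

lemma powser_abel_mean:
  fixes c :: "nat \<Rightarrow> real"
  assumes "c \<longlonglongrightarrow> l"
  shows "((\<lambda>x. (1 - x) * (\<Sum>n. c n * x ^ n)) \<longlongrightarrow> l) (at_left 1)"
proof -
  have B: "Bseq c" using assms by (intro convergent_imp_Bseq) (auto simp: convergent_def)
  have geo: "(\<lambda>n. x ^ n) sums (1 / (1 - x))" if "0 < x" "x < 1" for x :: real
    using that by (intro geometric_sums) auto
  have "((\<lambda>x. (\<Sum>n. 1 * (c n - l) * x ^ n) / (\<Sum>n. 1 * x ^ n)) \<longlongrightarrow> 0) (at_left 1)"
  proof (rule powser_ratio_tendsto_zero)
    show "(\<lambda>n. c n - l) \<longlonglongrightarrow> 0" using assms by (simp add: LIM_zero)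
    show "summable (\<lambda>n. 1 * x ^ n)" if "0 < x" "x < 1" for x :: real
      using geo[OF that] by (simp add: sums_iff)
    have "\<forall>\<^sub>F x in at_left (1::real). 1 / (1 - x) = (\<Sum>n. 1 * x ^ n)"
      using at_left_1 by eventually_elim (use geo in \<open>auto simp: sums_iff\<close>)
    then show "filterlim (\<lambda>x::real. \<Sum>n. 1 * x ^ n) at_top (at_left 1)"
      using filterlim_inverse_at_left_1 by (rule filterlim_cong[OF refl refl, THEN iffD1])
  qed simp
  from tendsto_add[OF this tendsto_const[of l]]
  have "((\<lambda>x. (\<Sum>n. 1 * (c n - l) * x ^ n) / (\<Sum>n. 1 * x ^ n) + l) \<longlongrightarrow> l) (at_left 1)"
    by (simp only: add_0)
  moreover have "\<forall>\<^sub>F x in at_left 1. (\<Sum>n. 1 * (c n - l) * x ^ n) / (\<Sum>n. 1 * x ^ n) + l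
      = (1 - x) * (\<Sum>n. c n * x ^ n)"
    using at_left_1
  proof eventually_elim
    case (elim x)
    then have x: "0 < x" "x < 1" by auto
    have "(\<lambda>n. c n * x ^ n - l * x ^ n) sums ((\<Sum>n. c n * x ^ n) - l * (1 / (1 - x)))"
      by (intro sums_diff sums_mult geo x summable_sums summable_Bseq_power B) (use x in auto)
    then have "(\<Sum>n. 1 * (c n - l) * x ^ n) = (\<Sum>n. c n * x ^ n) - l * (1 / (1 - x))"
      by (simp add: sums_iff algebra_simps)
    moreover have "(\<Sum>n. 1 * x ^ n) = 1 / (1 - x)"
      using geo[OF x] by (simp add: sums_iff)
    ultimately show ?case using x by (simp only: divide_divide_eq_right) (simp add: field_simps)
  qed
  ultimately show ?thesis
    by (rule Lim_transform_eventually)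
qed

section \<open>The function F(a, 1 - a; 1; x)\<close>

locale generalized_grotzsch =
  fixes a :: real
  assumes a_pos: "0 < a" and a_le: "a \<le> 1 / 2"
begin

definition b :: real where "b = a * (1 - a)"

definition C :: real where "C = sin (pi * a) / pi"

definition c :: "nat \<Rightarrow> real" where
  "c n = pochhammer a n * pochhammer (1 - a) n / (fact n)\<^sup>2"

definition F :: "real \<Rightarrow> real" where "F x = (\<Sum>n. c n * x ^ n)"

definition F' :: "real \<Rightarrow> real" where "F' x = (\<Sum>n. diffs c n * x ^ n)"

definition T :: "real \<Rightarrow> real" where "T x = x * (1 - x) * F' x"

definition P :: "real \<Rightarrow> real" where "P x = F x - 2 * (1 - x) * F' x"

definition p :: "nat \<Rightarrow> real" where "p n = c n * (1 - 2 * b / real (Suc n))"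

lemma a_less_1: "a < 1" using a_le by simp

lemma b_pos: "0 < b" using a_pos a_less_1 by (simp add: b_def)

lemma b_le: "b \<le> 1 / 4"
proof -
  have "1 / 4 - b = (1 / 2 - a)\<^sup>2" by (simp add: b_def power2_eq_square algebra_simps)
  then show ?thesis using zero_le_power2[of "1 / 2 - a"] by linarith
qed

lemma C_pos: "0 < C"
  using a_pos a_less_1 by (auto simp: C_def intro!: divide_pos_pos sin_gt_zero)

lemma c_0 [simp]: "c 0 = 1" by (simp add: c_def)

lemma c_pos: "0 < c n"
  using a_pos a_less_1 by (auto simp: c_def intro!: divide_pos_pos mult_pos_pos pochhammer_pos)

lemma c_Suc: "c (Suc n) = c n * (real n * real (Suc n) + b) / (real (Suc n))\<^sup>2"
  by (simp add: c_def pochhammer_Suc b_def power2_eq_square divide_simps) (simp add: algebra_simps)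

text \<open>
  The hypergeometric equation \<open>(x (1 - x) F')' = b F\<close> in terms of coefficients.
\<close>

lemma c_rec: "diffs c n - real n * c n = b * c n / real (Suc n)"
  unfolding diffs_def c_Suc by (simp add: power2_eq_square divide_simps) (simp add: algebra_simps)

lemma Gamma_reflection: "rGamma a * rGamma (1 - a) = C"
proof -
  have "complex_of_real (rGamma a * rGamma (1 - a)) = complex_of_real C"
    using rGamma_reflection_complex[of "complex_of_real a"]
    by (simp add: C_def flip: rGamma_complex_of_real sin_of_real)
  then show ?thesis by (simp only: of_real_eq_iff)
qed

text \<open>
  The Pochhammer symbols are those of the Gamma product for \<open>1 / \<Gamma>(a)\<close> and \<open>1 / \<Gamma>(1 - a)\<close>, and the
  reflection formula evaluates the product of the limits. This is where \<open>sin (\<pi> a)\<close> comes from.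
\<close>

lemma n_c_tendsto: "(\<lambda>n. real n * c n) \<longlonglongrightarrow> C"
proof -
  have "(\<lambda>n. rGamma_series a n * rGamma_series (1 - a) n) \<longlonglongrightarrow> rGamma a * rGamma (1 - a)"
    by (intro tendsto_mult rGamma_series_LIMSEQ)
  then have "(\<lambda>n. rGamma_series a n * rGamma_series (1 - a) n * (real n / real (Suc n))) \<longlonglongrightarrow> C"
    using tendsto_mult[OF _ LIMSEQ_n_over_Suc_n] unfolding Gamma_reflection by force
  moreover have "\<forall>\<^sub>F n in sequentially. rGamma_series a n * rGamma_series (1 - a) n * (real n / real (Suc n))
      = real (Suc n) * c (Suc n)"
    using eventually_gt_at_top[of 0]
  proof eventually_elim
    case (elim n)
    have "exp (a * ln n) * exp ((1 - a) * ln n) = real n"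
      using elim by (simp flip: exp_add distrib_right)
    then have e: "fact n * exp (a * ln n) * (fact n * exp ((1 - a) * ln n)) = (fact n)\<^sup>2 * real n"
      by (simp add: power2_eq_square mult_ac)
    have "rGamma_series a n * rGamma_series (1 - a) n
        = pochhammer a (Suc n) * pochhammer (1 - a) (Suc n) / ((fact n)\<^sup>2 * real n)"
      unfolding e[symmetric] by (simp add: rGamma_series_def)
    then show ?case
      using elim by (simp only:) (simp add: c_def power2_eq_square divide_simps)
  qed
  ultimately have "(\<lambda>n. real (Suc n) * c (Suc n)) \<longlonglongrightarrow> C"
    by (rule Lim_transform_eventually)
  then show ?thesis by (rule LIMSEQ_imp_Suc)
qed

lemma c_tendsto_0: "c \<longlonglongrightarrow> 0"
proof -
  have "(\<lambda>n. (real n * c n) * inverse (real n)) \<longlonglongrightarrow> C * 0"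
    by (intro tendsto_mult n_c_tendsto lim_inverse_n)
  then have "(\<lambda>n. (real n * c n) * inverse (real n)) \<longlonglongrightarrow> 0"
    by simp
  moreover have "\<forall>\<^sub>F n in sequentially. (real n * c n) * inverse (real n) = c n"
    using eventually_gt_at_top[of 0] by eventually_elim (simp add: field_simps)
  ultimately show ?thesis by (rule Lim_transform_eventually)
qed

lemma Bseq_c: "Bseq c"
  using c_tendsto_0 by (intro convergent_imp_Bseq) (auto simp: convergent_def)

lemma F_sums: "\<bar>x\<bar> < 1 \<Longrightarrow> (\<lambda>n. c n * x ^ n) sums F x"
  unfolding F_def by (intro summable_sums summable_Bseq_power Bseq_c)

lemma F_0 [simp]: "F 0 = 1"
  using powser_sums_zero[of c] by (simp add: F_def sums_iff)

lemma F_deriv: "\<bar>x\<bar> < 1 \<Longrightarrow> (F has_real_derivative F' x) (at x)"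
  unfolding F_def [abs_def] F'_def by (intro DERIV_Bseq_power Bseq_c)

lemma F_reflect_deriv:
  assumes "\<bar>1 - x\<bar> < 1"
  shows "((\<lambda>x. F (1 - x)) has_real_derivative - F' (1 - x)) (at x)"
proof -
  have "((\<lambda>x. F (1 - x)) has_real_derivative F' (1 - x) * (- 1)) (at x)"
    by (rule DERIV_chain2[where f = F and g = "\<lambda>x. 1 - x", OF F_deriv[OF assms]])
       (auto intro!: derivative_eq_intros)
  then show ?thesis by simp
qed

lemma F'_sums: "\<bar>x\<bar> < 1 \<Longrightarrow> (\<lambda>n. b * c n / real (Suc n) * x ^ n) sums ((1 - x) * F' x)"
  using euler_operator_sums[OF Bseq_c] by (simp add: c_rec F'_def)

lemma T_deriv: "\<bar>x\<bar> < 1 \<Longrightarrow> (T has_real_derivative b * F x) (at x)"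
proof -
  assume x: "\<bar>x\<bar> < 1"
  have q: "Bseq (\<lambda>n. b * c n)" by (intro Bseq_mult Bfun_const Bseq_c)
  have "(\<Sum>n. b * c n * x ^ n) = b * F x"
    using sums_mult[OF F_sums[OF x], of b] by (simp add: sums_iff mult.assoc)
  then show ?thesis
    using euler_operator_deriv[OF Bseq_c q c_rec x] by (simp add: T_def[abs_def] F'_def)
qed

lemma P_sums: 
  assumes x: "\<bar>x\<bar> < 1"
  shows "(\<lambda>n. p n * x ^ n) sums P x"
proof -
  have "(\<lambda>n. c n * x ^ n - 2 * (b * c n / real (Suc n) * x ^ n)) sums (F x - 2 * ((1 - x) * F' x))"
    by (intro sums_diff sums_mult F_sums F'_sums x)
  then show ?thesis by (simp add: P_def p_def algebra_simps)
qed

lemma F_ge_1: "0 \<le> x \<Longrightarrow> x < 1 \<Longrightarrow> 1 \<le> F x"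
  using sums_le[OF _ sums_If_finite_set[of "{0}" "\<lambda>n. c n * x ^ n"] F_sums[of x]]
  by (auto simp: c_pos less_imp_le)

lemma F'_ge: "0 \<le> x \<Longrightarrow> x < 1 \<Longrightarrow> b \<le> (1 - x) * F' x"
  using sums_le[OF _ sums_If_finite_set[of "{0}" "\<lambda>n. b * c n / real (Suc n) * x ^ n"] F'_sums[of x]]
  by (auto simp: c_pos b_pos less_imp_le)

lemma F'_pos: "0 \<le> x \<Longrightarrow> x < 1 \<Longrightarrow> 0 < F' x"
  using F'_ge[of x] b_pos by (smt (verit) zero_less_mult_iff)

lemma p_pos: "0 < p n"
proof -
  have "2 * b / real (Suc n) \<le> 2 * b / 1"
    using b_pos by (intro divide_left_mono) auto
  also have "\<dots> < 1" using b_le by simp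
  finally show ?thesis by (simp add: p_def c_pos)
qed

lemma P_pos: assumes "0 \<le> x" "x < 1" shows "0 < P x"
proof -
  have "1 - 2 * b \<le> P x"
    using sums_le[OF _ sums_If_finite_set[of "{0}" "\<lambda>n. p n * x ^ n"]
        P_sums[of x]] assms p_pos
    by (auto simp: less_imp_le p_def[of 0])
  then show ?thesis using b_le by linarith
qed

lemma F_strict_mono:
  assumes "0 \<le> x" "x < y" "y < 1"
  shows "F x < F y"
proof (rule DERIV_pos_imp_increasing[OF \<open>x < y\<close>])
  fix z assume "x \<le> z" "z \<le> y"
  then show "\<exists>D. DERIV F z :> D \<and> 0 < D"
    using assms F'_pos[of z] F_deriv[of z] by auto
qed

text \<open>
  The first term of the series for \<open>(1 - x) F' x\<close> already gives \<open>F' x \<ge> b / (1 - x)\<close>, hence logarithmic growth.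
\<close>

lemma F_at_top: "filterlim F at_top (at_left 1)"
proof -
  have le: "1 - b * ln (1 - x) \<le> F x" if x: "0 < x" "x < 1" for x
  proof -
    have "F 0 + b * ln (1 - 0) \<le> F x + b * ln (1 - x)"
    proof (rule DERIV_nonneg_imp_nondecreasing[of 0 x "\<lambda>x. F x + b * ln (1 - x)"])
      fix z assume z: "0 \<le> z" "z \<le> x"
      have "((\<lambda>x. F x + b * ln (1 - x)) has_real_derivative F' z - b / (1 - z)) (at z)"
        using z x by (auto intro!: derivative_eq_intros F_deriv)
      moreover have "0 \<le> F' z - b / (1 - z)"
        using F'_ge[of z] z x by (simp add: field_simps)
      ultimately show "\<exists>D. DERIV (\<lambda>x. F x + b * ln (1 - x)) z :> D \<and> 0 \<le> D" by blast
    qed (use x in auto)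
    then show ?thesis by simp
  qed
  have "filterlim (\<lambda>x::real. ln (1 - x)) at_bot (at_left 1)"
    by (rule filterlim_compose[OF ln_at_0 one_minus_at_right_0])
  then have "filterlim (\<lambda>x::real. - ln (1 - x)) at_top (at_left 1)"
    by (simp add: filterlim_uminus_at_top)
  then have "filterlim (\<lambda>x::real. 1 + b * (- ln (1 - x))) at_top (at_left 1)"
    by (intro filterlim_tendsto_add_at_top[OF tendsto_const]
        filterlim_tendsto_pos_mult_at_top[OF tendsto_const b_pos])
  then show ?thesis
    by (rule filterlim_at_top_mono) (use at_left_1 le in \<open>auto elim!: eventually_mono\<close>)
qed

lemma F_abel: "((\<lambda>x. (1 - x) * F x) \<longlongrightarrow> 0) (at_left 1)"
  unfolding F_def by (rule powser_abel_mean[OF c_tendsto_0])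

text \<open>
  This determines the Wronskian of \<open>F x\<close> and \<open>F (1 - x)\<close>, which is otherwise only known to be constant.
\<close>

lemma F'_abel: "((\<lambda>x. (1 - x) * F' x) \<longlongrightarrow> C) (at_left 1)"
  unfolding F'_def
proof (rule powser_abel_mean)
  show "diffs c \<longlonglongrightarrow> C"
    using LIMSEQ_Suc[OF n_c_tendsto] unfolding diffs_def .
qed

section \<open>The logarithmic solution and the connection formula\<close>

abbreviation R :: real where "R \<equiv> ramanujan_R a"

text \<open>
  The function \<open>g x - F x ln x\<close> is the Frobenius solution at \<open>0\<close> with \<open>g x = (\<Sum>n. c n d n x\<^sup>n)\<close> and
  \<open>d n = 2 \<psi>(n + 1) - \<psi>(a + n) - \<psi>(1 - a + n)\<close>. The sum below is this expression after unrolling the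
  recursion of \<open>\<psi>\<close>; it makes both the recursion of \<open>d\<close> and the limit \<open>0\<close> accessible.
\<close>

definition d :: "nat \<Rightarrow> real" where
  "d n = R - (\<Sum>k<n. 1 / (a + k) + 1 / (1 - a + k) - 2 / real (Suc k))"

definition g :: "real \<Rightarrow> real" where "g x = (\<Sum>n. c n * d n * x ^ n)"

definition g' :: "real \<Rightarrow> real" where "g' x = (\<Sum>n. diffs (\<lambda>n. c n * d n) n * x ^ n)"

text \<open>
  The Ramanujan constant is exactly the value of the full series that \<open>d\<close> subtracts, by the limit formulas
  for \<open>\<psi>\<close> and \<open>\<gamma>\<close>. Thus \<open>g\<close> is negligible against \<open>F\<close> at \<open>1\<close>.
\<close>

lemma d_tendsto_0: "d \<longlonglongrightarrow> 0"
proof -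
  have h: "(\<Sum>k<n. 2 / real (Suc k)) = 2 * harm n" for n
    by (simp add: harm_def sum.atLeast1_atMost_eq sum_distrib_left inverse_eq_divide lessThan_Suc_atMost)
  have "(\<lambda>n. R + ((ln (real n) - (\<Sum>k<n. inverse (a + real k)))
        + (ln (real n) - (\<Sum>k<n. inverse (1 - a + real k))) + 2 * (harm n - ln (real n))))
        \<longlonglongrightarrow> R + (Digamma a + Digamma (1 - a) + 2 * euler_mascheroni)"
    using Digamma_LIMSEQ[of a] Digamma_LIMSEQ[of "1 - a"] a_pos a_less_1
    by (intro tendsto_intros euler_mascheroni_LIMSEQ) auto
  moreover have "d = (\<lambda>n. R + ((ln (real n) - (\<Sum>k<n. inverse (a + real k)))
        + (ln (real n) - (\<Sum>k<n. inverse (1 - a + real k))) + 2 * (harm n - ln (real n))))"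
    by (rule ext) (simp add: d_def sum_subtractf sum.distrib h inverse_eq_divide del: of_nat_Suc)
  moreover have "R + (Digamma a + Digamma (1 - a) + 2 * euler_mascheroni) = 0"
    by (simp add: ramanujan_R_def)
  ultimately show ?thesis by (simp only:)
qed

lemma d_Suc: "d (Suc n) = d n - (real (Suc n) - 2 * b) / ((real n * real (Suc n) + b) * real (Suc n))"
proof -
  let ?S = "real (Suc n)" and ?D = "real n * real (Suc n) + b"
  have D: "?D > 0" using b_pos by (simp add: add_nonneg_pos)
  have eq: "(a + n) * (1 - a + n) = ?D"
    by (simp add: b_def algebra_simps)
  have "1 / (a + n) + 1 / (1 - a + n) = (2 * real n + 1) / ?D"
    unfolding eq[symmetric] using a_pos a_less_1 by (subst add_frac_eq) auto
  then have "1 / (a + n) + 1 / (1 - a + n) - 2 / ?S = (2 * real n + 1) / ?D - 2 / ?S"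
    by simp
  also have "\<dots> = ((2 * real n + 1) * ?S - 2 * ?D) / (?D * ?S)"
    using D by (subst diff_frac_eq) auto
  also have "(2 * real n + 1) * ?S - 2 * ?D = ?S - 2 * b"
    by (simp add: algebra_simps)
  finally show ?thesis by (simp add: d_def)
qed

lemma Bseq_cd: "Bseq (\<lambda>n. c n * d n)"
  using d_tendsto_0 by (intro Bseq_mult Bseq_c convergent_imp_Bseq) (auto simp: convergent_def)

lemma Bseq_p: "Bseq p"
  unfolding p_def [abs_def]
proof (intro Bseq_mult Bseq_c)
  show "Bseq (\<lambda>n. 1 - 2 * b / real (Suc n))"
    using Bseq_add[OF Bseq_minus_iff[THEN iffD2, OF Bseq_div_Suc[of "\<lambda>_. 2 * b"]], of 1] by simp
qed

lemma Bseq_q: "Bseq (\<lambda>n. b * (c n * d n) - p n)"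
proof -
  obtain B1 where B1: "\<And>n. \<bar>c n * d n\<bar> \<le> B1" using Bseq_cd unfolding Bseq_def by auto
  obtain B2 where B2: "\<And>n. \<bar>p n\<bar> \<le> B2"
    using Bseq_p unfolding Bseq_def by auto
  show ?thesis
  proof (rule BseqI')
    fix n
    have "\<bar>b * (c n * d n)\<bar> \<le> b * B1"
      using B1[of n] b_pos by (simp add: abs_mult)
    then show "norm (b * (c n * d n) - p n) \<le> b * B1 + B2"
      using B2[of n] unfolding real_norm_def by linarith
  qed
qed

lemma cd_rec: "diffs (\<lambda>n. c n * d n) n - real n * (c n * d n)
    = (b * (c n * d n) - p n) / real (Suc n)"
proof -
  have pos: "real n * real (Suc n) + b > 0" using b_pos by (simp add: add_nonneg_pos)
  have alg: "S * (x * D / S\<^sup>2 * (y - (S - z) / (D * S))) = S * (x * D / S\<^sup>2) * y - x * (S - z) / S\<^sup>2"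
    if "S \<noteq> 0" "D \<noteq> 0" for S D x y z :: real
    using that by (simp add: field_simps power2_eq_square)
  have alg': "(m * x + z * x / S) * y - x * (S - 2 * z) / S\<^sup>2
      = m * (x * y) + (z * (x * y) - x * (1 - 2 * z / S)) / S"
    if "S \<noteq> 0" for S m x y z :: real
    using that by (simp add: field_simps power2_eq_square)
  have "real (Suc n) * (c (Suc n) * d (Suc n)) = real (Suc n) * c (Suc n) * d n
      - c n * (real (Suc n) - 2 * b) / (real (Suc n))\<^sup>2"
    unfolding d_Suc c_Suc using pos by (intro alg) auto
  also have "\<dots> = (real n * c n + b * c n / real (Suc n)) * d n
      - c n * (real (Suc n) - 2 * b) / (real (Suc n))\<^sup>2"
    using c_rec[of n] by (simp add: diffs_def del: of_nat_Suc)
  also have "\<dots> = real n * (c n * d n)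
      + (b * (c n * d n) - p n) / real (Suc n)"
    unfolding p_def by (rule alg') simp
  finally show ?thesis by (simp add: diffs_def del: of_nat_Suc)
qed

lemma g_deriv: "\<bar>x\<bar> < 1 \<Longrightarrow> (g has_real_derivative g' x) (at x)"
  unfolding g_def [abs_def] g'_def by (intro DERIV_Bseq_power Bseq_cd)

text \<open>
  The inhomogeneity \<open>- P\<close> is the one produced by the logarithm: \<open>g x - F x ln x\<close> satisfies the same equation
  as \<open>F\<close>.
\<close>

lemma g_ode:
  assumes x: "\<bar>x\<bar> < 1"
  shows "((\<lambda>x. x * (1 - x) * g' x) has_real_derivative b * g x - P x) (at x)"
proof -
  have "(\<lambda>n. b * (c n * d n * x ^ n) - p n * x ^ n) sums (b * g x - P x)"
    unfolding g_def
    by (intro sums_diff sums_mult P_sums summable_sums summable_Bseq_power Bseq_cd x)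
  then have "(\<Sum>n. (b * (c n * d n) - p n) * x ^ n) = b * g x - P x"
    by (simp add: sums_iff left_diff_distrib mult.assoc)
  then show ?thesis
    using euler_operator_deriv[OF Bseq_cd Bseq_q cd_rec x] by (simp only: g'_def)
qed

lemma g_0: "g 0 = R"
  using powser_sums_zero[of "\<lambda>n. c n * d n"] by (simp add: g_def sums_iff d_def)

text \<open>
  This is the Wronskian of \<open>F\<close> and \<open>g x - F x ln x\<close>, multiplied out so that the logarithms cancel. In this form
  it is smooth at \<open>0\<close>, where it can be evaluated.
\<close>

lemma wronskian_log:
  assumes x: "\<bar>x\<bar> < 1"
  shows "F x * (x * (1 - x) * g' x) - T x * g x - (1 - x) * (F x)\<^sup>2 = - 1"
proof -
  let ?w = "\<lambda>x. F x * (x * (1 - x) * g' x) - T x * g x - (1 - x) * (F x)\<^sup>2"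
  have "\<exists>k. \<forall>x\<in>{-1<..<1}. ?w x = k"
  proof (rule has_field_derivative_zero_constant)
    fix z :: real assume "z \<in> {-1<..<1}"
    then have z: "\<bar>z\<bar> < 1" by auto
    show "(?w has_field_derivative 0) (at z within {-1<..<1})"
      by (rule has_field_derivative_at_within)
         (rule derivative_eq_intros F_deriv z g_ode T_deriv g_deriv refl
           | simp add: T_def P_def power2_eq_square algebra_simps)+
  qed simp
  then obtain k where k: "\<And>y. \<bar>y\<bar> < 1 \<Longrightarrow> ?w y = k" by (auto simp: abs_less_iff)
  from k[of 0] have "k = -1" by (simp add: T_def)
  with k[OF x] show ?thesis by simp
qed

lemma F_reflect_tendsto: "((\<lambda>x. F (1 - x)) \<longlongrightarrow> 1) (at_left 1)"
proof -
  have "isCont F 0" using F_deriv[of 0] DERIV_isCont by auto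
  moreover have "((\<lambda>x::real. 1 - x) \<longlongrightarrow> 0) (at_left 1)"
    by (auto intro!: tendsto_eq_intros)
  ultimately show ?thesis
    using isCont_tendsto_compose[of 0 F] by fastforce
qed

text \<open>
  The generalized Legendre relation. The equation is invariant under \<open>x \<mapsto> 1 - x\<close>, so the Wronskian is
  constant; letting \<open>x\<close> tend to \<open>1\<close>, the first summand vanishes and the second one tends to \<open>C\<close>.
\<close>

lemma wronskian_reflect:
  assumes x: "0 < x" "x < 1"
  shows "F x * T (1 - x) + T x * F (1 - x) = C"
proof -
  let ?w = "\<lambda>x. F x * T (1 - x) + T x * F (1 - x)"
  have "\<exists>k. \<forall>x\<in>{0<..<1}. ?w x = k"
  proof (rule has_field_derivative_zero_constant)
    fix z :: real assume "z \<in> {0<..<1}"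
    then have z: "\<bar>z\<bar> < 1" "\<bar>1 - z\<bar> < 1" by auto
    have "((\<lambda>x. T (1 - x)) has_real_derivative b * F (1 - z) * (- 1)) (at z)"
      by (rule DERIV_chain2[where f = T and g = "\<lambda>x. 1 - x", OF T_deriv[OF z(2)]])
         (auto intro!: derivative_eq_intros)
    then have "(?w has_real_derivative (F z * (b * F (1 - z) * (- 1)) + F' z * T (1 - z)
        + (T z * (- F' (1 - z)) + b * F z * F (1 - z)))) (at z)"
      by (intro DERIV_add DERIV_mult' F_deriv F_reflect_deriv T_deriv z)
    moreover have "F z * (b * F (1 - z) * (- 1)) + F' z * T (1 - z)
        + (T z * (- F' (1 - z)) + b * F z * F (1 - z)) = 0"
      by (simp add: T_def)
    ultimately have "(?w has_real_derivative 0) (at z)" by (simp only:)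
    then show "(?w has_field_derivative 0) (at z within {0<..<1})"
      by (rule has_field_derivative_at_within)
  qed simp
  then obtain k where k: "\<And>y. 0 < y \<Longrightarrow> y < 1 \<Longrightarrow> ?w y = k" by auto
  have contF': "isCont F' 0"
    unfolding F'_def [abs_def]
    by (rule isCont_powser[where K = "1 / 2"])
       (use summable_diffs_Bseq_power[OF Bseq_c, of "1 / 2"] in auto)
  have to0: "((\<lambda>x::real. 1 - x) \<longlongrightarrow> 0) (at_left 1)"
    by (auto intro!: tendsto_eq_intros)
  have "((\<lambda>x. ((1 - x) * F x) * (x * F' (1 - x)) + (x * ((1 - x) * F' x)) * F (1 - x))
      \<longlongrightarrow> 0 * (1 * F' 0) + (1 * C) * 1) (at_left 1)"
    by (intro tendsto_intros F_abel F'_abel F_reflect_tendsto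
        isCont_tendsto_compose[OF contF' to0])
  moreover have "\<forall>\<^sub>F x in at_left 1.
      ((1 - x) * F x) * (x * F' (1 - x)) + (x * ((1 - x) * F' x)) * F (1 - x) = k"
    using at_left_1
  proof eventually_elim
    case (elim x)
    then show ?case using k[of x] by (simp add: T_def mult_ac)
  qed
  ultimately have "((\<lambda>x. k) \<longlongrightarrow> 0 * (1 * F' 0) + (1 * C) * 1) (at_left (1::real))"
    by (rule Lim_transform_eventually)
  then have "k = C" by (simp add: tendsto_const_iff)
  then show ?thesis using k[OF x] by simp
qed

lemma ratio_deriv:
  assumes x: "0 < x" "x < 1"
  shows "((\<lambda>x. F (1 - x) / F x) has_real_derivative - C / (x * (1 - x) * (F x)\<^sup>2)) (at x)"
proof -
  have Fx: "F x > 0" using F_ge_1[of x] x by simp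
  have "((\<lambda>x. F (1 - x) / F x) has_real_derivative
      ((- F' (1 - x)) * F x - F (1 - x) * F' x) / (F x * F x)) (at x)"
    by (intro DERIV_divide F_reflect_deriv F_deriv) (use x Fx in auto)
  moreover have "- C = x * (1 - x) * ((- F' (1 - x)) * F x - F (1 - x) * F' x)"
    using wronskian_reflect[OF x] by (simp add: T_def algebra_simps)
  ultimately show ?thesis using x Fx by (simp add: power2_eq_square)
qed

lemma ratio_tendsto_0: "((\<lambda>x. F (1 - x) / F x) \<longlongrightarrow> 0) (at_left 1)"
  by (rule real_tendsto_divide_at_top[OF F_reflect_tendsto F_at_top])

text \<open>
  Ramanujan's asymptotic formula for \<open>F\<close> at \<open>1\<close> in exact form. After division by \<open>F x\<close> both sides have the
  derivative \<open>- C / (x (1 - x) (F x)\<^sup>2)\<close> and tend to \<open>0\<close> at \<open>1\<close>.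
\<close>

lemma connection_formula:
  assumes x: "0 < x" "x < 1"
  shows "F (1 - x) = C * (g x - F x * ln x)"
proof -
  let ?k = "\<lambda>x. F (1 - x) / F x - C * (g x / F x - ln x)"
  have "\<exists>k. \<forall>x\<in>{0<..<1}. ?k x = k"
  proof (rule has_field_derivative_zero_constant)
    fix z :: real assume "z \<in> {0<..<1}"
    then have z: "0 < z" "z < 1" "\<bar>z\<bar> < 1" by auto
    have Fz: "F z > 0" using F_ge_1[of z] z by simp
    have "(?k has_real_derivative - C / (z * (1 - z) * (F z)\<^sup>2)
        - C * ((g' z * F z - g z * F' z) / (F z * F z) - 1 / z)) (at z)"
      using z Fz by (intro DERIV_diff DERIV_cmult DERIV_divide ratio_deriv g_deriv F_deriv DERIV_ln_divide) auto
    moreover have "(g' z * F z - g z * F' z) / (F z * F z) - 1 / z = - 1 / (z * (1 - z) * (F z)\<^sup>2)"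
    proof -
      have "(g' z * F z - g z * F' z) * (z * (1 - z)) = (1 - z) * (F z)\<^sup>2 - 1"
        using wronskian_log[OF z(3)] by (simp add: T_def algebra_simps)
      then have "g' z * F z - g z * F' z = ((1 - z) * (F z)\<^sup>2 - 1) / (z * (1 - z))"
        using z by (simp add: eq_divide_eq)
      moreover have "((1 - z) * (F z)\<^sup>2 - 1) / (z * (1 - z)) / (F z * F z) - 1 / z
          = - 1 / (z * (1 - z) * (F z)\<^sup>2)"
        using z Fz by (simp add: divide_simps power2_eq_square)
      ultimately show ?thesis by (simp only:)
    qed
    ultimately have "(?k has_real_derivative 0) (at z)" by simp
    then show "(?k has_field_derivative 0) (at z within {0<..<1})"
      by (rule has_field_derivative_at_within)
  qed simp
  then obtain k where k: "\<And>y. 0 < y \<Longrightarrow> y < 1 \<Longrightarrow> ?k y = k" by auto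
  have 2: "((\<lambda>x. g x / F x) \<longlongrightarrow> 0) (at_left 1)"
    unfolding g_def F_def
    by (rule powser_ratio_tendsto_zero[OF _ d_tendsto_0])
       (use c_pos F_sums F_at_top in \<open>auto simp: less_imp_le sums_iff F_def[abs_def]\<close>)
  have "(?k \<longlongrightarrow> 0 - C * (0 - ln 1)) (at_left 1)"
    by (intro tendsto_intros ratio_tendsto_0 2) simp
  moreover have "\<forall>\<^sub>F x in at_left 1. ?k x = k"
    using at_left_1 by (rule eventually_mono) (use k in blast)
  ultimately have "((\<lambda>x. k) \<longlongrightarrow> 0 - C * (0 - ln 1)) (at_left (1::real))"
    by (rule Lim_transform_eventually)
  then have "k = 0" by (simp add: tendsto_const_iff)
  then show ?thesis
    using k[OF x] F_ge_1[of x] x by (simp add: field_simps)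
qed

section \<open>The modulus and its defect from the logarithm\<close>

definition h :: "real \<Rightarrow> real" where "h x = (1 - x) * (F x)\<^sup>2"

definition M :: "real \<Rightarrow> real" where "M x = F (1 - x) / (2 * C * F x)"

text \<open>
  For \<open>m = M x\<close>, the tangent at \<open>m\<close> to the graph of \<open>ln x\<close> as a function of \<open>m\<close> meets the axis \<open>m = 0\<close> at
  height \<open>2 W x\<close>.
\<close>

definition W :: "real \<Rightarrow> real" where "W x = h x * M x + ln x / 2"

lemma F_pos: "0 \<le> x \<Longrightarrow> x < 1 \<Longrightarrow> 0 < F x"
  using F_ge_1[of x] by simp

lemma h_pos: "0 \<le> x \<Longrightarrow> x < 1 \<Longrightarrow> 0 < h x"
  using F_pos[of x] by (simp add: h_def)

lemma M_pos: "0 < x \<Longrightarrow> x < 1 \<Longrightarrow> 0 < M x"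
  using F_pos[of x] F_pos[of "1 - x"] C_pos by (simp add: M_def)

lemma M_deriv:
  assumes x: "0 < x" "x < 1"
  shows "(M has_real_derivative - 1 / (2 * x * h x)) (at x)"
proof -
  have "((\<lambda>x. 1 / (2 * C) * (F (1 - x) / F x)) has_real_derivative
      1 / (2 * C) * (- C / (x * (1 - x) * (F x)\<^sup>2))) (at x)"
    by (intro DERIV_cmult ratio_deriv x)
  then show ?thesis
    using C_pos by (simp add: M_def [abs_def] h_def mult_ac)
qed

lemma h_deriv:
  assumes x: "\<bar>x\<bar> < 1"
  shows "(h has_real_derivative - (F x * P x)) (at x)"
  unfolding h_def [abs_def] P_def
  by (rule derivative_eq_intros F_deriv x refl | simp add: power2_eq_square algebra_simps)+

lemma h_strict_antimono:
  assumes "0 \<le> x" "x < y" "y < 1"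
  shows "h y < h x"
proof (rule DERIV_neg_imp_decreasing[OF \<open>x < y\<close>])
  fix z assume "x \<le> z" "z \<le> y"
  then show "\<exists>D. DERIV h z :> D \<and> D < 0"
    using assms F_pos[of z] P_pos[of z] h_deriv[of z] by (intro exI[of _ "- (F z * P z)"]) auto
qed

lemma M_strict_antimono:
  assumes "0 < x" "x < y" "y < 1"
  shows "M y < M x"
proof (rule DERIV_neg_imp_decreasing[OF \<open>x < y\<close>])
  fix z assume "x \<le> z" "z \<le> y"
  then show "\<exists>D. DERIV M z :> D \<and> D < 0"
    using assms h_pos[of z] M_deriv[of z]
    by (intro exI[of _ "- 1 / (2 * z * h z)"]) auto
qed

text \<open>
  The term \<open>h M'\<close> cancels the derivative of the logarithm, so only \<open>h' M\<close> remains.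
\<close>

lemma W_deriv:
  assumes x: "0 < x" "x < 1"
  shows "(W has_real_derivative - (P x * F (1 - x) / (2 * C))) (at x)"
proof -
  have hx: "h x > 0" and Fx: "F x > 0" using h_pos[of x] F_pos[of x] x by auto
  have "(W has_real_derivative
      (h x * (- 1 / (2 * x * h x)) + - (F x * P x) * M x + 1 / x / 2)) (at x)"
    unfolding W_def [abs_def]
    by (intro DERIV_add DERIV_mult' DERIV_cdivide h_deriv M_deriv DERIV_ln_divide) (use x in auto)
  moreover have "h x * (- 1 / (2 * x * h x)) + - (F x * P x) * M x + 1 / x / 2
      = - (P x * F (1 - x) / (2 * C))"
    using hx Fx x C_pos by (simp add: M_def field_simps)
  ultimately show ?thesis by (simp only:)
qed

lemma W_tendsto_0: "(W \<longlongrightarrow> 0) (at_left 1)"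
proof -
  have "((\<lambda>x. ((1 - x) * F x) * F (1 - x) / (2 * C) + ln x / 2) \<longlongrightarrow> 0 * 1 / (2 * C) + ln 1 / 2) (at_left 1)"
    using C_pos by (intro tendsto_intros F_abel F_reflect_tendsto) auto
  then have "((\<lambda>x. ((1 - x) * F x) * F (1 - x) / (2 * C) + ln x / 2) \<longlongrightarrow> 0) (at_left 1)"
    by simp
  moreover have "\<forall>\<^sub>F x in at_left 1. ((1 - x) * F x) * F (1 - x) / (2 * C) + ln x / 2 = W x"
    using at_left_1
  proof eventually_elim
    case (elim x)
    then show ?case
      using F_pos[of x] C_pos by (simp add: W_def M_def h_def power2_eq_square)
  qed
  ultimately show ?thesis by (rule Lim_transform_eventually)
qed

text \<open>
  By the connection formula \<open>W x = (1 - x) F x g x / 2 - (h x - 1) ln x / 2\<close>. Here \<open>h x - 1 = O(x)\<close>, so the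
  second part vanishes and the first one tends to \<open>g 0 / 2\<close>.
\<close>

lemma W_tendsto_R: "(W \<longlongrightarrow> R / 2) (at_right 0)"
proof -
  have cont: "isCont F 0" "isCont g 0"
    using F_deriv[of 0] g_deriv[of 0] DERIV_isCont by auto
  have F0: "(F \<longlongrightarrow> 1) (at_right 0)"
    using cont(1) by (auto simp: isCont_def intro: tendsto_mono[OF at_le])
  have g0: "(g \<longlongrightarrow> R) (at_right 0)"
    using cont(2) by (auto simp: isCont_def g_0 intro: tendsto_mono[OF at_le])
  have "((\<lambda>x. (h x - h 0) / (x - 0)) \<longlongrightarrow> - (F 0 * P 0)) (at_right 0)"
    using h_deriv[of 0] unfolding has_field_derivative_iff
    by (auto intro: tendsto_mono[OF at_le])
  then have "((\<lambda>x. (1 - x) * F x * g x / 2 - ((h x - h 0) / (x - 0)) * (x * ln x) / 2) \<longlongrightarrow>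
      (1 - 0) * 1 * R / 2 - (- (F 0 * P 0)) * 0 / 2) (at_right 0)"
    by (intro tendsto_intros F0 g0 x_ln_x_tendsto_0) auto
  then have "((\<lambda>x. (1 - x) * F x * g x / 2 - ((h x - h 0) / (x - 0)) * (x * ln x) / 2) \<longlongrightarrow> R / 2) (at_right 0)"
    by simp
  moreover have "\<forall>\<^sub>F x in at_right 0.
      (1 - x) * F x * g x / 2 - ((h x - h 0) / (x - 0)) * (x * ln x) / 2 = W x"
    using eventually_at_right_real[of 0 "1::real", simplified]
  proof eventually_elim
    case (elim x)
    then have x: "0 < x" "x < 1" by auto
    have "h x * M x = (1 - x) * F x * (g x - F x * ln x) / 2"
      using F_pos[of x] x C_pos
      by (simp add: M_def h_def connection_formula power2_eq_square)
    moreover have "((h x - h 0) / (x - 0)) * (x * ln x) = (h x - 1) * ln x"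
      using x by (simp add: h_def[of 0])
    ultimately have "(1 - x) * F x * g x / 2 - ((h x - h 0) / (x - 0)) * (x * ln x) / 2
        = (1 - x) * F x * g x / 2 - (h x - 1) * ln x / 2"
      and "W x = (1 - x) * F x * (g x - F x * ln x) / 2 + ln x / 2"
      by (simp_all only: W_def)
    then show ?case
      by (simp only:) (simp add: h_def power2_eq_square field_simps)
  qed
  ultimately show ?thesis by (rule Lim_transform_eventually)
qed

section \<open>The exponent\<close>

definition e :: real where "e = b * (1 - b) / (1 - 2 * b)"

lemma lam_eq: "lam a = 2 * e"
proof -
  have "1 - a + a\<^sup>2 = 1 - b" "a\<^sup>2 + (1 - a)\<^sup>2 = 1 - 2 * b"
    by (simp_all add: b_def power2_eq_square algebra_simps)
  then show ?thesis by (simp add: lam_def e_def b_def mult.assoc)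
qed

lemma e_less_1: "e < 1"
proof -
  have "b * (1 - b) \<le> 1 / 4 * 1" using b_pos b_le by (intro mult_mono) auto
  then show ?thesis using b_le by (simp add: e_def)
qed

text \<open>
  The coefficientwise form of \<open>(1 - x) P' \<le> e P\<close>. For \<open>n = 0\<close> it is an equality, which is what fixes the value of
  the exponent \<open>e = \<lambda> / 2\<close>.
\<close>

lemma p_rec_le: "real (Suc n) * p (Suc n) \<le> (real n + e) * p n"
proof -
  let ?S = "real (Suc n)"
  have b2: "1 - 2 * b > 0" using b_le by simp
  \<comment> \<open>The difference has the factor \<open>n\<close>, since equality holds at \<open>n = 0\<close>.\<close>
  have "(real n + e) * (?S - 2 * b) * (?S + 1) - (real n * ?S + b) * (?S + 1 - 2 * b)
      = b * real n * ((1 - b) * ?S - (1 - 2 * b - 2 * b\<^sup>2)) / (1 - 2 * b)"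
    using b2 by (simp add: e_def field_simps power2_eq_square)
  moreover have "(1 - b) * ?S \<ge> (1 - b) * 1" using b_le by (intro mult_left_mono) auto
  then have "(1 - b) * ?S - (1 - 2 * b - 2 * b\<^sup>2) \<ge> 0"
    using b_pos zero_le_power2[of b] unfolding mult_1_right by (smt (verit))
  ultimately have key: "(real n * ?S + b) * (?S + 1 - 2 * b) \<le> (real n + e) * (?S - 2 * b) * (?S + 1)"
    using b2 b_pos by (smt (verit) divide_nonneg_pos mult_nonneg_nonneg of_nat_0_le_iff)
  have "?S * p (Suc n) = c n * ((real n * ?S + b) * (?S + 1 - 2 * b)) / (?S * (?S + 1))"
    by (simp add: p_def c_Suc power2_eq_square divide_simps)
  also have "\<dots> \<le> c n * ((real n + e) * (?S - 2 * b) * (?S + 1)) / (?S * (?S + 1))"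
    using c_pos[of n] key by (intro divide_right_mono mult_left_mono) auto
  also have "\<dots> = (real n + e) * p n"
    by (simp add: p_def divide_simps)
  finally show ?thesis .
qed

definition P' :: "real \<Rightarrow> real" where "P' x = (\<Sum>n. diffs p n * x ^ n)"

lemma P_deriv: 
  assumes x: "\<bar>x\<bar> < 1"
  shows "(P has_real_derivative P' x) (at x)"
proof -
  have "((\<lambda>x. \<Sum>n. p n * x ^ n) has_real_derivative P' x) (at x)"
    unfolding P'_def by (rule DERIV_Bseq_power[OF _ x]) (rule Bseq_p)
  then show ?thesis
    by (rule has_field_derivative_transform_within_open[where S = "{-1<..<1}"])
       (use x P_sums in \<open>auto simp: sums_iff\<close>)
qed

lemma P'_le:
  assumes x: "0 \<le> x" "x < 1"
  shows "(1 - x) * P' x \<le> e * P x"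
proof -
  have 1: "(\<lambda>n. (diffs p n - real n * p n) * x ^ n) sums ((1 - x) * P' x)"
    unfolding P'_def by (rule euler_operator_sums) (use Bseq_p x in simp_all)
  have 2: "(\<lambda>n. e * (p n * x ^ n)) sums (e * P x)"
    by (intro sums_mult) (use P_sums x in simp)
  show ?thesis
  proof (rule sums_le[OF _ 1 2])
    fix n
    have "diffs p n - real n * p n \<le> e * p n"
      using p_rec_le[of n] unfolding diffs_def by (simp add: distrib_right)
    then show "(diffs p n - real n * p n) * x ^ n \<le> e * (p n * x ^ n)"
      using x mult_right_mono[of "diffs p n - real n * p n" "e * p n" "x ^ n"]
      by (simp add: mult.assoc)
  qed
qed

lemma P_powr_antimono:
  assumes "0 < x" "x \<le> y" "y < 1"
  shows "P y * (1 - y) powr e \<le> P x * (1 - x) powr e"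
proof (rule DERIV_nonpos_imp_nonincreasing[OF \<open>x \<le> y\<close>])
  fix z assume "x \<le> z" "z \<le> y"
  then have z: "0 < z" "z < 1" using assms by auto
  have "((\<lambda>x. P x * (1 - x) powr e) has_real_derivative
      P z * (e * (1 - z) powr (e - 1) * (- 1)) + P' z * (1 - z) powr e) (at z)"
    by (rule DERIV_mult' P_deriv derivative_eq_intros refl | use z in simp)+
  moreover have "(1 - z) powr e = (1 - z) * (1 - z) powr (e - 1)"
    using z by (simp add: powr_diff)
  then have "P z * (e * (1 - z) powr (e - 1) * (- 1)) + P' z * (1 - z) powr e
      = ((1 - z) * P' z - e * P z) * (1 - z) powr (e - 1)"
    by (simp only:) (simp add: algebra_simps)
  then have "P z * (e * (1 - z) powr (e - 1) * (- 1)) + P' z * (1 - z) powr e \<le> 0"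
    using P'_le[of z] z by (simp add: mult_nonpos_nonneg)
  ultimately show "\<exists>D. DERIV (\<lambda>x. P x * (1 - x) powr e) z :> D \<and> D \<le> 0" by blast
qed

text \<open>
  The monotone l'Hospital argument, organized around a zero \<open>x0\<close> of \<open>Z = W - \<kappa> V\<close>. The derivative of \<open>Z\<close> has the
  sign of \<open>\<kappa> (1 - e) - \<rho>\<close>, which can only change from negative to positive because \<open>\<rho>\<close> decreases. As \<open>Z\<close>
  also tends to \<open>0\<close> at \<open>1\<close>, the sign is not positive at \<open>x0\<close>. So \<open>Z\<close> decreases to the left of \<open>x0\<close>, and its limit
  \<open>R / 2 - \<kappa>\<close> at \<open>0\<close> is nonnegative.
\<close>

lemma W_le:
  assumes x0: "0 < x0" "x0 < 1"
  shows "W x0 \<le> R / 2 * (1 - x0) powr (1 - e)"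
proof -
  define V where "V = (\<lambda>x::real. (1 - x) powr (1 - e))"
  define \<rho> where "\<rho> = (\<lambda>x. F (1 - x) * (P x * (1 - x) powr e) / (2 * C))"
  have V0: "V x0 > 0" using x0 by (simp add: V_def)
  define \<kappa> where "\<kappa> = W x0 / V x0"
  define Z where "Z = (\<lambda>x. W x - \<kappa> * V x)"
  have Zx0: "Z x0 = 0" using V0 by (simp add: Z_def \<kappa>_def)
  have \<rho>_anti: "\<rho> y < \<rho> x" if "0 < x" "x < y" "y < 1" for x y
  proof -
    have "F (1 - y) * (P y * (1 - y) powr e) < F (1 - x) * (P x * (1 - x) powr e)"
      using that F_strict_mono[of "1 - y" "1 - x"] P_powr_antimono[of x y] P_pos[of y] F_pos[of "1 - x"] F_pos[of "1 - y"]
      by (intro mult_less_le_imp_less) auto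
    then show ?thesis using C_pos by (simp add: \<rho>_def divide_strict_right_mono)
  qed
  have Z_deriv: "(Z has_real_derivative (1 - x) powr (- e) * (\<kappa> * (1 - e) - \<rho> x)) (at x)"
    if x: "0 < x" "x < 1" for x
  proof -
    have "(V has_real_derivative (1 - e) * (1 - x) powr (- e) * (- 1)) (at x)"
      unfolding V_def by (rule derivative_eq_intros refl | use x in simp)+
    then have "(Z has_real_derivative - (P x * F (1 - x) / (2 * C))
        - \<kappa> * ((1 - e) * (1 - x) powr (- e) * (- 1))) (at x)"
      unfolding Z_def by (intro DERIV_diff DERIV_cmult W_deriv x)
    moreover have "(1 - x) powr (- e) * (1 - x) powr e = 1"
      using x by (simp flip: powr_add)
    moreover have "(1 - x) powr (- e) * \<rho> x
        = ((1 - x) powr (- e) * (1 - x) powr e) * (P x * F (1 - x) / (2 * C))"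
      by (simp add: \<rho>_def mult_ac)
    ultimately show ?thesis by (simp add: algebra_simps)
  qed
  have \<rho>x0: "\<rho> x0 \<ge> \<kappa> * (1 - e)"
  proof (rule ccontr)
    assume neg: "\<not> \<rho> x0 \<ge> \<kappa> * (1 - e)"
    have inc: "Z x < Z y" if "x0 \<le> x" "x < y" "y < 1" for x y
    proof (rule DERIV_pos_imp_increasing[OF \<open>x < y\<close>])
      fix z assume "x \<le> z" "z \<le> y"
      then have z: "x0 \<le> z" "0 < z" "z < 1" using that x0 by auto
      have "\<rho> z \<le> \<rho> x0" using \<rho>_anti[of x0 z] z x0 by (cases "z = x0") auto
      then show "\<exists>D. DERIV Z z :> D \<and> 0 < D"
        using neg z Z_deriv[of z] by (intro exI[of _ "(1 - z) powr (- e) * (\<kappa> * (1 - e) - \<rho> z)"]) auto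
    qed
    obtain x1 where x1: "x0 < x1" "x1 < 1" using x0 dense by blast
    have "\<forall>\<^sub>F y in at_left 1. Z x1 \<le> Z y"
      using eventually_at_left_real[OF x1(2)]
      by (rule eventually_mono) (use inc[of x1] x1 in \<open>auto simp: less_imp_le\<close>)
    moreover have "(Z \<longlongrightarrow> 0) (at_left 1)"
    proof -
      have "((\<lambda>x. W x - \<kappa> * (1 - x) powr (1 - e)) \<longlongrightarrow> 0 - \<kappa> * 0) (at_left 1)"
      proof (intro tendsto_diff tendsto_mult tendsto_const W_tendsto_0)
        have "((\<lambda>x. (1 - x) powr (1 - e)) \<longlongrightarrow> 0 powr (1 - e)) (at_left (1::real))"
          by (rule tendsto_powr')
             (use e_less_1 at_left_1 in \<open>auto intro!: tendsto_eq_intros elim!: eventually_mono\<close>)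
        then show "((\<lambda>x. (1 - x) powr (1 - e)) \<longlongrightarrow> 0) (at_left (1::real))" by simp
      qed
      then show ?thesis by (simp add: Z_def V_def)
    qed
    ultimately have "Z x1 \<le> 0"
      by (intro tendsto_lowerbound[where F = "at_left 1" and f = Z]) auto
    then show False using inc[of x0 x1] x1 Zx0 by simp
  qed
  have "Z x \<ge> 0" if x: "0 < x" "x < x0" for x
  proof -
    have "Z x0 \<le> Z x"
    proof (rule DERIV_nonpos_imp_nonincreasing[of x x0 Z])
      fix z assume "x \<le> z" "z \<le> x0"
      then have z: "0 < z" "z \<le> x0" "z < 1" using x x0 by auto
      have "\<rho> x0 \<le> \<rho> z" using \<rho>_anti[of z x0] z x0 by (cases "z = x0") auto
      then show "\<exists>D. DERIV Z z :> D \<and> D \<le> 0"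
        using \<rho>x0 z Z_deriv[of z]
        by (intro exI[of _ "(1 - z) powr (- e) * (\<kappa> * (1 - e) - \<rho> z)"])
           (auto simp: mult_nonneg_nonpos)
    qed (use x in simp)
    then show ?thesis using Zx0 by simp
  qed
  then have "\<forall>\<^sub>F x in at_right 0. 0 \<le> Z x"
    using eventually_at_right_real[OF x0(1)] by (auto elim!: eventually_mono)
  moreover have "(Z \<longlongrightarrow> R / 2 - \<kappa> * (1 - 0) powr (1 - e)) (at_right 0)"
    unfolding Z_def V_def by (intro tendsto_intros W_tendsto_R) auto
  ultimately have "0 \<le> R / 2 - \<kappa> * (1 - 0) powr (1 - e)"
    by (intro tendsto_lowerbound[where F = "at_right 0" and f = Z]) auto
  then have "\<kappa> \<le> R / 2" by simp
  then show ?thesis using V0 by (simp add: \<kappa>_def V_def divide_le_eq)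
qed

section \<open>The distortion function in the modulus coordinate\<close>

lemma M_reflect: "0 < x \<Longrightarrow> x < 1 \<Longrightarrow> M (1 - x) = 1 / (4 * C\<^sup>2 * M x)"
  using F_pos[of x] F_pos[of "1 - x"] C_pos by (simp add: M_def power2_eq_square)

lemma M_arbitrarily_small:
  assumes "0 < m"
  obtains x where "0 < x" "x < 1" "M x < m"
proof -
  have "((\<lambda>x. 1 / (2 * C) * (F (1 - x) / F x)) \<longlongrightarrow> 1 / (2 * C) * 0) (at_left 1)"
    by (intro tendsto_mult tendsto_const ratio_tendsto_0)
  then have "(M \<longlongrightarrow> 0) (at_left 1)" by (simp add: M_def [abs_def])
  then have "\<forall>\<^sub>F x in at_left 1. M x < m" using assms by (rule order_tendstoD)
  with at_left_1 have "\<forall>\<^sub>F x in at_left 1. 0 < x \<and> x < 1 \<and> M x < m"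
    by eventually_elim auto
  then show ?thesis
    using that eventually_happens'[of "at_left (1::real)"] trivial_limit_at_left_real by blast
qed

lemma M_continuous: "continuous_on {0<..<1} M"
proof (intro continuous_at_imp_continuous_on ballI)
  fix x :: real assume "x \<in> {0<..<1}"
  then show "isCont M x" using DERIV_isCont[OF M_deriv[of x]] by simp
qed

text \<open>
  Small values occur near \<open>1\<close>, and large ones near \<open>0\<close> by the reflection \<open>x \<mapsto> 1 - x\<close>.
\<close>

lemma M_surj:
  assumes m: "0 < m"
  shows "m \<in> M ` {0<..<1}"
proof -
  obtain y where y: "0 < y" "y < 1" "M y < m" using M_arbitrarily_small[OF m] .
  have "0 < 1 / (4 * C\<^sup>2 * m)" using m C_pos by simp
  then obtain z where z: "0 < z" "z < 1" "M z < 1 / (4 * C\<^sup>2 * m)"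
    using M_arbitrarily_small by blast
  have Mz: "m < M (1 - z)"
    using z m C_pos M_pos[of z] by (simp add: M_reflect field_simps)
  have "1 - z < y"
  proof (rule ccontr)
    assume "\<not> 1 - z < y"
    then have "M (1 - z) \<le> M y"
      using M_strict_antimono[of y "1 - z"] y z by (cases "y = 1 - z") auto
    then show False using y Mz by simp
  qed
  moreover have "continuous_on {1 - z..y} M"
    using y z by (intro continuous_on_subset[OF M_continuous]) auto
  ultimately obtain x where "1 - z \<le> x" "x \<le> y" "M x = m"
    using IVT2'[of M y m "1 - z"] y Mz by auto
  then show ?thesis using y z by (intro image_eqI[of _ _ x]) auto
qed

lemma M_inj: "inj_on M {0<..<1}"
proof (rule inj_onI)
  fix x y assume "x \<in> {0<..<1}" "y \<in> {0<..<1}" "M x = M y"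
  then show "x = y"
    using M_strict_antimono[of x y] M_strict_antimono[of y x] by (cases x y rule: linorder_cases) auto
qed

definition N :: "real \<Rightarrow> real" where "N = inv_into {0<..<1} M"

lemma N_props:
  assumes "0 < m"
  shows "0 < N m" "N m < 1" "M (N m) = m"
  using inv_into_into[OF M_surj[OF assms]] f_inv_into_f[OF M_surj[OF assms]]
  by (auto simp: N_def)

lemma N_M: "0 < x \<Longrightarrow> x < 1 \<Longrightarrow> N (M x) = x"
  unfolding N_def by (intro inv_into_f_f M_inj) auto

lemma N_strict_antimono:
  assumes "0 < m" "m < n"
  shows "N n < N m"
proof (rule ccontr)
  assume "\<not> N n < N m"
  then have "M (N n) \<le> M (N m)"
    using M_strict_antimono[of "N m" "N n"] N_props[of m] N_props[of n] assms
    by (cases "N m = N n") auto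
  then show False using N_props assms by simp
qed

text \<open>
  As \<open>h\<close> decreases in \<open>x\<close> and \<open>N\<close> decreases in \<open>m\<close>, the derivative decreases: this is the concavity that drives
  the two inequalities below.
\<close>

lemma ln_N_deriv:
  assumes m: "0 < m"
  shows "((\<lambda>m. ln (N m)) has_real_derivative - 2 * h (N m)) (at m)"
proof -
  note N = N_props[OF m]
  have hN: "h (N m) > 0" using h_pos[of "N m"] N by simp
  let ?D = "- 1 / (2 * N m * h (N m))"
  have "(M has_derivative (*) ?D) (at (N m))"
    using M_deriv[OF N(1,2)] by (simp add: has_field_derivative_def)
  then have "(N has_derivative (*) (- 2 * N m * h (N m))) (at m)"
    by (rule has_derivative_inverse_strong_x[where S = "{0<..<1}" and f = M, rotated 4])
       (use N hN N_M M_continuous in \<open>auto simp: fun_eq_iff\<close>)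
  then have "(N has_real_derivative - 2 * N m * h (N m)) (at m)"
    by (simp add: has_field_derivative_def)
  then have "((\<lambda>m. ln (N m)) has_real_derivative 1 / N m * (- 2 * N m * h (N m))) (at m)"
    by (rule DERIV_chain2[where f = ln and g = N, OF DERIV_ln_divide[OF N(1)]])
  then show ?thesis using N(1) by simp
qed

lemma scaled_ln_N_strict_mono:
  assumes K: "1 < K" and m: "0 < m" "m < n"
  shows "ln (N (m / K)) - ln (N m) / K < ln (N (n / K)) - ln (N n) / K"
proof (rule DERIV_pos_imp_increasing[OF \<open>m < n\<close>])
  fix z assume "m \<le> z" "z \<le> n"
  then have z: "0 < z" "0 < z / K" "z / K < z" using m K by (auto simp: divide_less_eq)
  have "((\<lambda>x. ln (N (x / K))) has_real_derivative - 2 * h (N (z / K)) * (1 / K)) (at z)"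
    by (rule DERIV_chain2[where g = "\<lambda>x. x / K", OF ln_N_deriv[OF z(2)]]) (use K in \<open>auto intro!: derivative_eq_intros\<close>)
  then have "((\<lambda>x. ln (N (x / K)) - ln (N x) / K) has_real_derivative
      - 2 * h (N (z / K)) * (1 / K) - - 2 * h (N z) / K) (at z)"
    by (intro DERIV_diff DERIV_cdivide ln_N_deriv z)
  moreover have "h (N (z / K)) < h (N z)"
    using N_strict_antimono[OF z(2,3)] N_props[OF z(1)] N_props[OF z(2)]
    by (intro h_strict_antimono) auto
  then have "- 2 * h (N (z / K)) * (1 / K) - - 2 * h (N z) / K > 0"
    using K by (simp add: divide_strict_right_mono)
  ultimately show "\<exists>D. DERIV (\<lambda>x. ln (N (x / K)) - ln (N x) / K) z :> D \<and> D > 0" by blast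
qed

text \<open>
  A concave function lies below its tangent at \<open>m\<close>. Evaluated at \<open>m / K\<close>, the tangent has the height
  \<open>ln (N m) / K + (1 - 1 / K) 2 W (N m)\<close>, a mean of its values at \<open>m\<close> and at \<open>0\<close>.
\<close>

lemma scaled_ln_N_le:
  assumes K: "1 < K" and m: "0 < m"
  shows "ln (N (m / K)) - ln (N m) / K \<le> (1 - 1 / K) * (2 * W (N m))"
proof -
  have mK: "0 < m / K" "m / K < m" using m K by (auto simp: divide_less_eq)
  obtain z where z: "m / K < z" "z < m"
    and eq: "ln (N m) - ln (N (m / K)) = (m - m / K) * (- 2 * h (N z))"
    using MVT2[OF mK(2), of "\<lambda>x. ln (N x)" "\<lambda>z. - 2 * h (N z)"] ln_N_deriv mK
    by (meson less_le_trans)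
  have "h (N z) < h (N m)"
    using N_strict_antimono[of z m] N_props[of z] N_props[OF m] z mK
    by (intro h_strict_antimono) auto
  then have "(m - m / K) * h (N z) \<le> (m - m / K) * h (N m)"
    using mK by (intro mult_left_mono) auto
  then have "ln (N (m / K)) \<le> ln (N m) + 2 * ((m - m / K) * h (N m))"
    using eq by simp
  moreover have "(1 - 1 / K) * (2 * W (N m)) = ln (N m) - ln (N m) / K + 2 * ((m - m / K) * h (N m))"
    using N_props[OF m] by (simp add: W_def algebra_simps diff_divide_distrib)
  ultimately show ?thesis by simp
qed

section \<open>The distortion function\<close>

lemma hyp2F1_eq_F: "hyp2F1 a (1 - a) 1 x = F x"
  unfolding hyp2F1_def F_def
  by (intro suminf_cong) (simp add: c_def power2_eq_square flip: pochhammer_fact)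

lemma mu_eq_M: "mu a r = M (r\<^sup>2)"
  unfolding mu_def hyp2F1_eq_F by (simp add: M_def C_def)

lemma square_in_unit:
  assumes "0 < r" "r < 1"
  shows "0 < r\<^sup>2" "r\<^sup>2 < (1 :: real)"
  using assms by (auto simp: power_less_one_iff)

lemma phi_square:
  assumes K: "1 < K" and r: "0 < r" "r < 1"
  shows "0 < phi a K r" "(phi a K r)\<^sup>2 = N (M (r\<^sup>2) / K)"
proof -
  define m where "m = M (r\<^sup>2) / K"
  have m: "0 < m" using M_pos square_in_unit[OF r] K by (simp add: m_def)
  note N = N_props[OF m]
  have "mu a (sqrt (N m)) = m" using N by (simp add: mu_eq_M)
  then have im: "m \<in> mu a ` {0<..<1}"
    using N by (intro image_eqI[of _ _ "sqrt (N m)"]) auto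
  have phi: "phi a K r = inv_into {0<..<1} (mu a) m"
    by (simp add: phi_def mu_eq_M m_def)
  have unit: "0 < phi a K r" "phi a K r < 1"
    using inv_into_into[OF im] by (auto simp: phi)
  have "M ((phi a K r)\<^sup>2) = m"
    using f_inv_into_f[OF im] by (simp add: phi mu_eq_M)
  then show "0 < phi a K r" "(phi a K r)\<^sup>2 = N (M (r\<^sup>2) / K)"
    using N_M[OF square_in_unit[OF unit]] unit by (auto simp: m_def)
qed

definition L :: "real \<Rightarrow> real \<Rightarrow> real" where "L K r = ln (phi a K r) - ln r / K"

lemma L_eq:
  assumes K: "1 < K" and r: "0 < r" "r < 1"
  shows "2 * L K r = ln (N (M (r\<^sup>2) / K)) - ln (N (M (r\<^sup>2))) / K"
proof -
  have "ln (N (M (r\<^sup>2) / K)) = 2 * ln (phi a K r)"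
    unfolding phi_square(2)[OF assms, symmetric] by (simp add: ln_realpow)
  moreover have "ln (N (M (r\<^sup>2))) = 2 * ln r"
    unfolding N_M[OF square_in_unit[OF r]] by (simp add: ln_realpow)
  ultimately show ?thesis by (simp add: L_def right_diff_distrib)
qed

lemma L_strict_antimono:
  assumes K: "1 < K" and r: "0 < r" "r < t" "t < 1"
  shows "L K t < L K r"
proof -
  have "M (t\<^sup>2) < M (r\<^sup>2)"
    using square_in_unit[of r] square_in_unit[of t] r
    by (intro M_strict_antimono power_strict_mono) auto
  then have "2 * L K t < 2 * L K r"
    using scaled_ln_N_strict_mono[OF K, of "M (t\<^sup>2)" "M (r\<^sup>2)"] M_pos square_in_unit[of t] r K
    by (simp add: L_eq)
  then show ?thesis by simp
qed

lemma L_le: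
  assumes K: "1 < K" and r: "0 < r" "r < 1"
  shows "L K r \<le> (1 - 1 / K) * (ramanujan_R a / 2 * compl_mod r powr (2 - lam a))"
proof -
  note sq = square_in_unit[OF r]
  have V: "compl_mod r powr (2 - lam a) = (1 - r\<^sup>2) powr (1 - e)"
    using sq by (simp add: compl_mod_def lam_eq powr_powr diff_divide_distrib flip: powr_half_sqrt)
  have "2 * L K r \<le> (1 - 1 / K) * (2 * W (r\<^sup>2))"
    using scaled_ln_N_le[OF K M_pos[OF sq]] unfolding L_eq[OF assms] N_M[OF sq] .
  also have "\<dots> \<le> (1 - 1 / K) * (2 * (R / 2 * (1 - r\<^sup>2) powr (1 - e)))"
    using W_le[OF sq] K by (intro mult_left_mono) auto
  finally show ?thesis unfolding V by simp
qed

end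

theorem mainTheorem6:
  fixes a r t K :: real
  assumes "a \<in> {0<..1/2}" and "r \<in> {0<..<1}" and "t \<in> {0<..<1}" and "K \<in> {1<..}"
  shows "phi a K r * phi a K t / phi a K (r * t)
           < exp (ramanujan_R a / 4 *
                  (compl_mod r powr (2 - lam a) + compl_mod t powr (2 - lam a)) * (1 - 1 / K)) \<and>
         (\<forall>p\<in>{0<..<1}. phi a K r powr p / phi a K (r powr p)
           > exp (ramanujan_R a / 2 * (p - 1) * compl_mod r powr (2 - lam a) * (1 - 1 / K))) \<and>
         (\<forall>p\<in>{1<..}. phi a K r powr p / phi a K (r powr p)
           < exp (ramanujan_R a / 2 * (p - 1) * compl_mod r powr (2 - lam a) * (1 - 1 / K)))"
proof -
  interpret generalized_grotzsch a
    using assms(1) by unfold_locales auto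
  have r: "0 < r" "r < 1" and t: "0 < t" "t < 1" and K: "1 < K" using assms by auto
  define B where "B = (\<lambda>r. ramanujan_R a / 2 * compl_mod r powr (2 - lam a) * (1 - 1 / K))"
  have LB: "L K x \<le> B x" if "0 < x" "x < 1" for x
    using L_le[OF K that] by (simp add: B_def mult_ac)
  have phi_exp: "phi a K x = exp (L K x + ln x / K)" if "0 < x" "x < 1" for x
    using phi_square(1)[OF K that] by (simp add: L_def)
  have rt: "0 < r * t" "r * t < r" "r * t < t" "r * t < 1"
    using r t mult_strict_mono[of r 1 t 1] by auto
  have "phi a K r * phi a K t / phi a K (r * t)
      = exp ((L K r + ln r / K) + (L K t + ln t / K) - (L K (r * t) + ln (r * t) / K))"
    using r t rt by (simp add: phi_exp exp_add exp_diff)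
  also have "\<dots> = exp (L K r + L K t - L K (r * t))"
    using r t by (simp add: ln_mult add_divide_distrib)
  also have "\<dots> < exp ((B r + B t) / 2)"
    using L_strict_antimono[OF K rt(1,2) r(2)] L_strict_antimono[OF K rt(1,3) t(2)] LB[OF r] LB[OF t]
    by simp
  also have "(B r + B t) / 2 = ramanujan_R a / 4 *
      (compl_mod r powr (2 - lam a) + compl_mod t powr (2 - lam a)) * (1 - 1 / K)"
    using K by (simp add: B_def field_simps)
  finally have product: "phi a K r * phi a K t / phi a K (r * t)
      < exp (ramanujan_R a / 4 *
          (compl_mod r powr (2 - lam a) + compl_mod t powr (2 - lam a)) * (1 - 1 / K))" .
  have power_eq: "phi a K r powr p / phi a K (r powr p) = exp (p * L K r - L K (r powr p))"
    if p: "0 < p" for p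
  proof -
    have rp: "0 < r powr p" "r powr p < 1" using r p powr_less_mono2[of p r 1] by auto
    have "phi a K r powr p / phi a K (r powr p)
        = exp (p * (L K r + ln r / K) - (L K (r powr p) + ln (r powr p) / K))"
      using r rp by (simp add: phi_exp exp_diff exp_powr_real mult.commute)
    then show ?thesis using r by (simp add: ln_powr algebra_simps)
  qed
  have bound_eq: "ramanujan_R a / 2 * (p - 1) * compl_mod r powr (2 - lam a) * (1 - 1 / K) = (p - 1) * B r"
    for p by (simp add: B_def mult_ac)
  have "exp ((p - 1) * B r) < phi a K r powr p / phi a K (r powr p)" if p: "0 < p" "p < 1" for p
  proof -
    have "r powr 1 < r powr p" using r p by (intro powr_less_mono') auto
    then have "L K (r powr p) < L K r"
      using r p by (intro L_strict_antimono K) (use powr_less_mono2[of p r 1] in auto)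
    moreover have "(1 - p) * L K r \<le> (1 - p) * B r"
      using p LB[OF r] by (intro mult_left_mono) auto
    ultimately show ?thesis
      unfolding power_eq[OF p(1)] by (simp add: algebra_simps)
  qed
  moreover have "phi a K r powr p / phi a K (r powr p) < exp ((p - 1) * B r)" if p: "1 < p" for p
  proof -
    have "r powr p < r powr 1" using r p by (intro powr_less_mono') auto
    then have "L K r < L K (r powr p)"
      using r p by (intro L_strict_antimono K) auto
    moreover have "(p - 1) * L K r \<le> (p - 1) * B r"
      using p LB[OF r] by (intro mult_left_mono) auto
    moreover have "0 < p" using p by simp
    ultimately show ?thesis
      by (simp add: power_eq algebra_simps)
  qed
  ultimately show ?thesis
    using product unfolding bound_eq by auto
qed

end
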